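(* Let $\mu$ be an $s$-Frostman measure on $\mathbb{S}^1$ for $s\in[0,1]$. For all $p\le 1+s$, it holds $$\|\mathcal{K}_\delta f\|_{L^p(d\mu)}\lessapprox\delta^{1-2/p}\,\|f\|_{L^p(\mathbb{R}^2)}.$$
   Context: Here $\delta\in(0,1)$. A $\delta$-tube in $\mathbb{R}^2$ is the closed $(\delta/2)$-neighbourhood of a unit line segment; its direction $\omega(T)\in\mathbb{S}^1$ is the direction of the segment. The Kakeya maximal operator is $$\mathcal{K}_\delta f(\omega):=\sup_{\omega(T)=\omega}\frac{1}{\mathrm{Leb}(T)}\int_T|f(y)|\,dy,\qquad f\in L^1_{\mathrm{loc}}(\mathbb{R}^2),\ \omega\in\mathbb{S}^1,$$ where the supremum is taken over all $\delta$-tubes $T$ with direction $\omega$ and $\mathrm{Leb}$ is Lebesgue measure. A Borel measure $\mu$ on $\mathbb{S}^1$ is called an $s$-Frostman measure if there is some constant $C>0$ such that $\mu(B(\omega,r))\le Cr^s$ for all $\omega\in\mathbb{S}^1$ and $r>0$. The notation $A\lessapprox B$ means that $A\le C(\log(1/\delta))^{C}B$ for some absolute constant $C>0$. Logarithms are in base $2$.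
   Formalization: Proved for 1 ≤ p ≤ 1+s (the inequality fails for p < 1), with log(1/δ) replaced by max(1, log(1/δ)) (it fails as δ → 1 otherwise), and with the constant depending on the Frostman constant of μ (unavoidable, by scaling μ). *)

theory Defs
  imports "HOL-Analysis.Analysis"
begin

text \<open>
  The maximal function of a locally integrable function may be infinite, so it takes values in
  \<^typ>\<open>ennreal\<close>. The power below is only meant for exponents \<open>p > 0\<close>.
\<close>

definition epowr :: "ennreal \<Rightarrow> real \<Rightarrow> ennreal" where
  "epowr x p = (if x = \<infinity> then \<infinity> else ennreal (enn2real x powr p))"

definition Lp_norm :: "'a measure \<Rightarrow> real \<Rightarrow> ('a \<Rightarrow> ennreal) \<Rightarrow> ennreal" where
  "Lp_norm M p g = epowr (\<integral>\<^sup>+x. epowr (g x) p \<partial>M) (1 / p)"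

definition L1_loc :: "(real^2 \<Rightarrow> real) \<Rightarrow> bool" where
  "L1_loc f \<longleftrightarrow> (\<forall>K. compact K \<longrightarrow> set_integrable lebesgue K f)"

definition tubes :: "real \<Rightarrow> real^2 \<Rightarrow> (real^2) set set" where
  "tubes \<delta> \<omega> = {T. \<exists>a. T = {y. infdist y (closed_segment a (a + \<omega>)) \<le> \<delta> / 2}}"

text \<open>
  The segments above have unit length only if \<open>\<omega>\<close> is a unit vector; the maximal function is
  only evaluated at such \<open>\<omega>\<close>. Note that \<^term>\<open>tubes \<delta> \<omega> = tubes \<delta> (- \<omega>)\<close>.
\<close>

definition kakeya_max :: "real \<Rightarrow> (real^2 \<Rightarrow> real) \<Rightarrow> real^2 \<Rightarrow> ennreal" where
  "kakeya_max \<delta> f \<omega> =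
     (SUP T\<in>tubes \<delta> \<omega>. (\<integral>\<^sup>+y\<in>T. ennreal \<bar>f y\<bar> \<partial>lebesgue) / emeasure lebesgue T)"

definition borel_measure_on_circle :: "(real^2) measure \<Rightarrow> bool" where
  "borel_measure_on_circle \<mu> \<longleftrightarrow> sets \<mu> = sets (restrict_space borel (sphere 0 1))"

text \<open>
  The Frostman constant \<open>A\<close> is kept as a parameter because estimates for \<open>\<mu>\<close> depend on it.
\<close>

definition frostman_with :: "real \<Rightarrow> real \<Rightarrow> (real^2) measure \<Rightarrow> bool" where
  "frostman_with A s \<mu> \<longleftrightarrow> borel_measure_on_circle \<mu> \<and>
     (\<forall>\<omega>\<in>sphere 0 1. \<forall>r>0. emeasure \<mu> (cball \<omega> r \<inter> sphere 0 1) \<le> ennreal (A * r powr s))"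

definition frostman_measure :: "real \<Rightarrow> (real^2) measure \<Rightarrow> bool" where
  "frostman_measure s \<mu> \<longleftrightarrow> (\<exists>A>0. frostman_with A s \<mu>)"

text \<open>
  The factor \<open>C (log (1/\<delta>))^C\<close> hidden in the notation for inequalities up to logarithms. The
  logarithm is truncated from below at 1, which changes nothing for \<open>\<delta> \<le> 1/2\<close>; without it the
  factor would tend to 0 as \<open>\<delta>\<close> tends to 1, and the inequalities would fail there.
\<close>

definition log_loss :: "real \<Rightarrow> real \<Rightarrow> real" where
  "log_loss C \<delta> = C * (max 1 (log 2 (1 / \<delta>))) powr C"

end

theory Submission
  imports Defs
begin

text \<open>
  The critical exponent is \<open>p = 1 + s\<close>. For smaller \<open>p\<close> nothing new has to be done: on the circle, which
  has diameter 2, an \<open>s\<close>-Frostman measure is a \<open>t\<close>-Frostman measure for every \<open>t \<le> s\<close>, at the cost of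
  a factor 2, and one takes \<open>t = p - 1\<close>.

  The heart is a weak-type estimate for sets, \<open>weak_type_set\<close>. Call a direction rich if some tube
  \<open>T\<close> in this direction meets \<open>E\<close> in measure at least \<open>\<lambda>\<delta>\<close>
  (in the lemmas \<open>\<delta>\<close> and \<open>\<lambda>\<close> are \<open>d\<close> and \<open>l\<close>). Choose rich directions that are
  separated by \<open>\<rho> = K\<delta>/\<lambda>\<close>, where \<open>K\<close> is a large multiple of \<open>log (1/\<delta>)\<close>. Two tubes at angle
  \<open>\<theta>\<close> overlap in measure at most \<open>\<delta>\<^sup>2 / sin \<theta>\<close>, so one chosen tube loses at most
  \<open>\<Sum>k. \<delta>\<^sup>2 / (k\<rho>)\<close>, up to a constant, to all the others. By the choice of \<open>K\<close> this harmonic sum is at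
  most \<open>\<lambda>\<delta>/2\<close>. Hence the sets \<open>E \<inter> T\<close> contain disjoint pieces of measure \<open>\<lambda>\<delta>/2\<close>, and there are at
  most about \<open>|E| / (\<lambda>\<delta>)\<close> chosen directions. The \<open>\<rho>\<close>-balls around them cover all rich directions, so the
  Frostman condition bounds the measure of the rich set by a logarithm times
  \<open>(|E| / (\<lambda>\<delta>)) (\<delta>/\<lambda>)\<^bsup>p-1\<^esup> = |E| \<delta>\<^bsup>p-2\<^esup> \<lambda>\<^bsup>-p\<^esup>\<close>.
  An \<open>L\<^sup>2\<close> argument in the style of Cordoba, interpolated with the trivial \<open>L\<^sup>1\<close> bound, would miss the
  critical exponent when \<open>0 < s < 1\<close>; the disjointness argument does not.

  To pass to functions, let \<open>f\<close> have \<open>L\<^sup>p\<close> norm at most 1 and put \<open>\<beta> = \<delta>\<^bsup>1-2/p\<^esup> \<ge> 1\<close>. The part of \<open>f\<close>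
  of size at most 1 has averages at most \<open>1 \<le> \<beta>\<close>. The part of size at least \<open>\<delta>\<^bsup>-2\<^esup>\<close> is so concentrated
  that already its integral divided by \<open>\<delta>\<close> is at most \<open>\<beta>\<close>. Only about \<open>log (1/\<delta>)\<close> dyadic levels are
  left, and the weak-type estimate applies to each of them. This gives \<open>weak_type_function\<close>. Its bounds
  for the heights \<open>2\<^sup>j \<beta>\<close> contribute equally to the \<open>L\<^sup>p\<close> norm, and again only about \<open>log (1/\<delta>)\<close> heights
  matter, which gives \<open>strong_type\<close>.

  The maximal function is never shown to be measurable. Its super-level sets are instead covered by
  finite unions of balls, and it is compared with a simple function built from those.
\<close>

section \<open>Directions in the plane\<close>

definition perp :: "real^2 \<Rightarrow> real^2" where
  "perp w = vector [- w$2, w$1]"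

definition dir :: "real \<Rightarrow> real^2" where
  "dir t = vector [cos t, sin t]"

lemma norm_vec2: "norm (x::real^2) ^ 2 = (x$1)^2 + (x$2)^2"
  unfolding power2_norm_eq_inner by (simp add: inner_vec_def sum_2 power2_eq_square)

lemma inner_vec2: "inner x (y::real^2) = x$1 * y$1 + x$2 * y$2"
  by (simp add: inner_vec_def sum_2)

lemma norm_perp [simp]: "norm (perp w) = norm w"
proof -
  have "norm (perp w) ^ 2 = norm w ^ 2"
    by (simp add: norm_vec2 perp_def)
  then show ?thesis by (simp add: power2_eq_iff_nonneg)
qed

lemma norm_dir [simp]: "norm (dir t) = 1"
proof -
  have "norm (dir t) ^ 2 = 1 ^ 2"
    by (simp add: norm_vec2 dir_def)
  then show ?thesis by (simp only: power2_eq_iff_nonneg norm_ge_zero zero_le_one)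
qed

lemma dir_surj:
  assumes "norm w = 1"
  obtains t where "0 \<le> t" "t < 2 * pi" "w = dir t"
proof -
  have "(w$1)^2 + (w$2)^2 = 1" using norm_vec2[of w] assms by simp
  then obtain t where "0 \<le> t" "t < 2*pi" "w$1 = cos t" "w$2 = sin t"
    using sincos_total_2pi by blast
  then show ?thesis using that[of t] by (simp add: vec_eq_iff forall_2 dir_def)
qed

lemma dist_dir_le: "dist (dir s) (dir t) \<le> \<bar>s - t\<bar>"
proof -
  define h where "h = (s - t) / 2"
  have "(dist (dir s) (dir t))^2 = (cos s - cos t)^2 + (sin s - sin t)^2"
    by (simp add: dist_norm norm_vec2 dir_def)
  also have "\<dots> = 2 - 2 * cos (s - t)"
    using sin_cos_squared_add[of s] sin_cos_squared_add[of t]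
    by (simp add: cos_diff power2_eq_square algebra_simps)
  also have "cos (s - t) = 1 - 2 * (sin h)^2"
  proof -
    have "s - t = 2 * h" by (simp add: h_def)
    then show ?thesis using cos_double_sin[of h] by simp
  qed
  also have "2 - 2 * (1 - 2 * (sin h)^2) = (2 * sin h)^2" by (simp add: power2_eq_square)
  also have "\<dots> \<le> \<bar>s - t\<bar>^2"
  proof -
    have "\<bar>2 * sin h\<bar> \<le> \<bar>s - t\<bar>" using abs_sin_x_le_abs_x[of h] by (simp add: h_def)
    then show ?thesis by (metis abs_ge_zero abs_le_square_iff power2_abs abs_abs)
  qed
  finally show ?thesis by (rule power2_le_imp_le) simp
qed

lemma abs_sin_ge_half:
  assumes "\<bar>x\<bar> \<le> (1::real)"
  shows "\<bar>x\<bar> / 2 \<le> \<bar>sin x\<bar>"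
proof -
  have "\<bar>sin x - x\<bar> \<le> inverse (fact 3) * \<bar>x\<bar> ^ 3"
    using Maclaurin_sin_bound[of x 3] by (simp add: sin_coeff_def eval_nat_numeral)
  moreover have "\<bar>x\<bar> ^ 3 \<le> \<bar>x\<bar> ^ 1"
    by (rule power_decreasing) (use assms in auto)
  ultimately have "\<bar>sin x - x\<bar> \<le> \<bar>x\<bar> / 6" by (simp add: eval_nat_numeral)
  then show ?thesis by linarith
qed

section \<open>Measure and overlap of tubes\<close>

lemma tube_compact:
  assumes "T \<in> tubes d w" "d > 0"
  shows "compact T"
proof -
  obtain a where T: "T = {y. infdist y (closed_segment a (a + w)) \<le> d / 2}"
    using assms(1) unfolding tubes_def by auto
  show ?thesis unfolding T using assms(2) by (intro compact_infdist_le) auto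
qed

lemma tube_in_strip:
  assumes "T \<in> tubes d w"
  obtains a where "\<And>y. y \<in> T \<Longrightarrow> \<bar>inner (perp w) y - a\<bar> \<le> norm w * (d / 2)"
proof -
  obtain a where T: "T = {y. infdist y (closed_segment a (a + w)) \<le> d / 2}"
    using assms unfolding tubes_def by auto
  show ?thesis
  proof (rule that)
    fix y assume "y \<in> T"
    obtain x where x: "x \<in> closed_segment a (a + w)" "infdist y (closed_segment a (a + w)) = dist y x"
      using infdist_attains_inf[of "closed_segment a (a + w)" y] by auto
    have "inner (perp w) x = inner (perp w) a"
      using x(1) by (auto simp: closed_segment_def inner_vec2 perp_def algebra_simps)
    then have "\<bar>inner (perp w) y - inner (perp w) a\<bar> = \<bar>inner (perp w) (y - x)\<bar>"
      by (simp add: inner_diff_right)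
    also have "\<dots> \<le> norm w * norm (y - x)"
      using Cauchy_Schwarz_ineq2[of "perp w" "y - x"] by simp
    also have "\<dots> \<le> norm w * (d / 2)"
      using x(2) \<open>y \<in> T\<close> T by (intro mult_left_mono) (auto simp: dist_norm)
    finally show "\<bar>inner (perp w) y - inner (perp w) a\<bar> \<le> norm w * (d / 2)" .
  qed
qed

lemma measure_cbox_real2:
  fixes a b :: "real^2"
  assumes "a$1 \<le> b$1" "a$2 \<le> b$2"
  shows "measure lebesgue (cbox a b) = (b$1 - a$1) * (b$2 - a$2)"
proof -
  have "cbox a b \<noteq> {}" using assms by (auto simp: interval_ne_empty_cart forall_2)
  then show ?thesis by (simp add: content_cbox_cart prod_2 UNIV_2)
qed

text \<open>
  Each tube lies in a strip of width \<open>d\<close>. The linear map that reads off the two strip coordinates has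
  determinant \<open>\<plusminus> sin (t - s)\<close> and maps the intersection into a square of side \<open>d\<close>. Since the sine also
  vanishes at \<open>\<pi>\<close>, this takes care of the fact that opposite directions have the same tubes.
\<close>

lemma tube_overlap:
  assumes T: "T \<in> tubes d (dir s)" "T' \<in> tubes d (dir t)" and "d > 0"
  shows "measure lebesgue (T \<inter> T') * \<bar>sin (t - s)\<bar> \<le> d^2"
proof -
  obtain a where a: "\<And>y. y \<in> T \<Longrightarrow> \<bar>inner (perp (dir s)) y - a\<bar> \<le> d / 2"
    using tube_in_strip[OF T(1)] by auto
  obtain b where b: "\<And>y. y \<in> T' \<Longrightarrow> \<bar>inner (perp (dir t)) y - b\<bar> \<le> d / 2"
    using tube_in_strip[OF T(2)] by auto
  define f :: "real^2 \<Rightarrow> real^2"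
    where "f y = vector [inner (perp (dir s)) y, inner (perp (dir t)) y]" for y
  have lin: "linear f"
    by (rule linearI) (auto simp: f_def vec_eq_iff forall_2 inner_add_right)
  have det: "\<bar>det (matrix f)\<bar> = \<bar>sin (t - s)\<bar>"
    by (simp add: det_2 matrix_def f_def inner_axis perp_def dir_def sin_diff algebra_simps)
  have meas: "T \<inter> T' \<in> lmeasurable"
    using tube_compact[OF T(1) \<open>d > 0\<close>] tube_compact[OF T(2) \<open>d > 0\<close>] by (intro lmeasurable_compact compact_Int)
  define l u :: "real^2" where "l = vector [a - d/2, b - d/2]" and "u = vector [a + d/2, b + d/2]"
  have sub: "f ` (T \<inter> T') \<subseteq> cbox l u"
  proof
    fix z assume "z \<in> f ` (T \<inter> T')"
    then obtain y where y: "y \<in> T" "y \<in> T'" "z = f y" by auto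
    show "z \<in> cbox l u" using a[OF y(1)] b[OF y(2)]
      unfolding y(3) f_def l_def u_def mem_box_cart forall_2 vector_2 abs_le_iff by linarith
  qed
  have "measure lebesgue (T \<inter> T') * \<bar>sin (t - s)\<bar> = measure lebesgue (f ` (T \<inter> T'))"
    using measure_linear_image[OF lin meas] det by simp
  also have "\<dots> \<le> measure lebesgue (cbox l u)"
    using sub meas measurable_linear_image[OF lin meas] by (intro measure_mono_fmeasurable) auto
  also have "\<dots> = d^2"
    using \<open>d > 0\<close> by (subst measure_cbox_real2) (auto simp: l_def u_def power2_eq_square)
  finally show ?thesis .
qed

text \<open>
  The tube contains the \<open>1 \<times> d\<close> rectangle around its core segment, an isometric image of a box.
\<close>

lemma tube_measure_ge:
  assumes T: "T \<in> tubes d w" and w: "norm w = 1" and d: "d > 0"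
  shows "ennreal d \<le> emeasure lebesgue T"
proof -
  obtain a where Ta: "T = {y. infdist y (closed_segment a (a + w)) \<le> d / 2}"
    using T unfolding tubes_def by auto
  define f :: "real^2 \<Rightarrow> real^2" where "f x = (x$1) *\<^sub>R w + (x$2) *\<^sub>R perp w" for x
  have lin: "linear f"
    by (rule linearI) (auto simp: f_def algebra_simps)
  have "(w$1)^2 + (w$2)^2 = 1" using w norm_vec2[of w] by simp
  then have det: "\<bar>det (matrix f)\<bar> = 1"
    by (simp add: det_2 matrix_def f_def axis_def perp_def power2_eq_square)
  define l u :: "real^2" where "l = vector [0, - d/2]" and "u = vector [1, d/2]"
  have "measure lebesgue ((+) a ` f ` cbox l u) = measure lebesgue (cbox l u)"
    using measure_linear_image[OF lin, of "cbox l u"] det by (simp add: measure_translation)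
  also have "\<dots> = d" using d by (subst measure_cbox_real2) (auto simp: l_def u_def)
  finally have m: "measure lebesgue ((+) a ` f ` cbox l u) = d" .
  have sub: "(+) a ` f ` cbox l u \<subseteq> T"
  proof clarify
    fix x assume "x \<in> cbox l u"
    then have x: "0 \<le> x$1" "x$1 \<le> 1" "\<bar>x$2\<bar> \<le> d/2"
      by (auto simp: mem_box_cart forall_2 l_def u_def)
    have "a + (x$1) *\<^sub>R w \<in> closed_segment a (a + w)"
      using x by (auto simp: closed_segment_def algebra_simps intro!: exI[of _ "x$1"])
    then have "infdist (a + f x) (closed_segment a (a + w)) \<le> dist (a + f x) (a + (x$1) *\<^sub>R w)"
      by (rule infdist_le)
    also have "\<dots> = \<bar>x$2\<bar>" by (simp add: f_def dist_norm w)
    finally show "a + f x \<in> T" using x(3) by (simp add: Ta)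
  qed
  have Tm: "T \<in> lmeasurable" using tube_compact[OF T d] by (rule lmeasurable_compact)
  have "(+) a ` f ` cbox l u \<in> lmeasurable"
    using measurable_linear_image[OF lin, of "cbox l u"] by (simp add: measurable_translation)
  then have "d \<le> measure lebesgue T"
    using m sub Tm by (metis measure_mono_fmeasurable fmeasurableD)
  then show ?thesis using Tm by (simp add: emeasure_eq_measure2 ennreal_leI)
qed

section \<open>Counting sets with small overlaps\<close>

lemma harm_le_ln: "n > 0 \<Longrightarrow> harm n \<le> 1 + ln (real n)"
proof -
  assume "n > 0"
  then obtain m where m: "n = Suc m" by (cases n) auto
  have "harm (Suc m) - ln (real (Suc m)) \<le> harm (Suc 0) - ln (real (Suc 0))"
    using decseq_harm_diff_ln by (rule decseqD) simp
  then show ?thesis by (simp add: m harm_expand)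
qed

lemma sum_inverse_distance_le:
  fixes I :: "nat set"
  assumes "i \<le> N"
  shows "(\<Sum>j\<in>{j\<in>I. j < i}. 1 / (real i - real j)) \<le> harm N"
proof -
  have "(\<Sum>j\<in>{j\<in>I. j < i}. 1 / (real i - real j)) \<le> (\<Sum>j<i. 1 / (real i - real j))"
    using assms by (intro sum_mono2) auto
  also have "\<dots> = harm i"
    unfolding harm_def
    by (rule sum.reindex_bij_witness[of _ "\<lambda>k. i - k" "\<lambda>k. i - k"])
       (auto simp: of_nat_diff field_simps)
  also have "\<dots> \<le> harm N" using assms by (intro harm_mono)
  finally show ?thesis .
qed

text \<open>
  Remove from each \<open>E \<inter> T i\<close> the overlaps with all earlier sets. As the overlaps decay like the inverse
  of the distance of the indices, the total removed from one set is at most \<open>b * harm N\<close>, hence at most half of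
  \<open>a\<close>, and the remaining pieces are disjoint subsets of \<open>E\<close>.
\<close>

lemma card_le_of_small_overlaps:
  fixes T :: "nat \<Rightarrow> 'a set" and a b :: real
  assumes I: "finite I" "\<And>i. i \<in> I \<Longrightarrow> i \<le> N"
    and E: "E \<in> sets M" and T: "\<And>i. i \<in> I \<Longrightarrow> T i \<in> sets M"
    and a: "\<And>i. i \<in> I \<Longrightarrow> ennreal a \<le> emeasure M (E \<inter> T i)"
    and b: "\<And>i j. i \<in> I \<Longrightarrow> j \<in> I \<Longrightarrow> j < i \<Longrightarrow>
              emeasure M (T i \<inter> T j) \<le> ennreal (b / (real i - real j))"
    and ab: "0 \<le> a" "0 \<le> b" "b * harm N \<le> a / 2"
  shows "ennreal (card I * (a / 2)) \<le> emeasure M E"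
proof -
  define S where "S i = E \<inter> T i - (\<Union>j\<in>{j\<in>I. j < i}. T j)" for i
  have Sm: "S i \<in> sets M" if "i \<in> I" for i
    unfolding S_def using that I(1) T E by (intro sets.Diff sets.Int sets.finite_UN) auto
  have disj: "disjoint_family_on S I"
    unfolding disjoint_family_on_def
  proof (intro ballI impI)
    fix i j assume "i \<in> I" "j \<in> I" "i \<noteq> j"
    then show "S i \<inter> S j = {}" by (cases "i < j") (auto simp: S_def)
  qed
  have big: "ennreal (a / 2) \<le> emeasure M (S i)" if i: "i \<in> I" for i
  proof -
    let ?J = "{j\<in>I. j < i}"
    have UJ: "(\<Union>j\<in>?J. T i \<inter> T j) \<in> sets M"
      using I(1) T i by (intro sets.finite_UN) auto
    have "ennreal a \<le> emeasure M (E \<inter> T i)" using a[OF i] .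
    also have "\<dots> \<le> emeasure M (S i \<union> (\<Union>j\<in>?J. T i \<inter> T j))"
      using Sm[OF i] UJ by (intro emeasure_mono) (auto simp: S_def)
    also have "\<dots> \<le> emeasure M (S i) + emeasure M (\<Union>j\<in>?J. T i \<inter> T j)"
      using Sm[OF i] UJ by (rule emeasure_subadditive)
    also have "emeasure M (\<Union>j\<in>?J. T i \<inter> T j) \<le> (\<Sum>j\<in>?J. emeasure M (T i \<inter> T j))"
      using I(1) T i by (intro emeasure_subadditive_finite) auto
    also have "\<dots> \<le> (\<Sum>j\<in>?J. ennreal (b / (real i - real j)))"
      using b i by (intro sum_mono) auto
    also have "\<dots> = ennreal (\<Sum>j\<in>?J. b / (real i - real j))"
      using ab by (intro sum_ennreal) auto
    also have "(\<Sum>j\<in>?J. b / (real i - real j)) = b * (\<Sum>j\<in>?J. 1 / (real i - real j))"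
      by (simp add: sum_distrib_left)
    also have "ennreal \<dots> \<le> ennreal (a / 2)"
      using sum_inverse_distance_le[OF I(2)[OF i]] ab
      by (intro ennreal_leI) (meson mult_left_mono order_trans)
    finally have *: "ennreal a \<le> emeasure M (S i) + ennreal (a / 2)" by (simp add: add_left_mono)
    show ?thesis
    proof (cases "emeasure M (S i)")
      case (real r)
      then show ?thesis using * ab by (auto simp flip: ennreal_plus)
    qed auto
  qed
  have "ennreal (card I * (a / 2)) = (\<Sum>i\<in>I. ennreal (a / 2))"
    using ab by (simp add: ennreal_of_nat_eq_real_of_nat flip: ennreal_mult')
  also have "\<dots> \<le> (\<Sum>i\<in>I. emeasure M (S i))" using big by (intro sum_mono)
  also have "\<dots> = emeasure M (\<Union>i\<in>I. S i)"
    using Sm disj I(1) by (intro sum_emeasure) auto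
  also have "\<dots> \<le> emeasure M E" using E by (intro emeasure_mono) (auto simp: S_def)
  finally show ?thesis .
qed

section \<open>The weak-type estimate for sets\<close>

abbreviation logd :: "real \<Rightarrow> real" where
  "logd d \<equiv> max 1 (log 2 (1 / d))"

lemma harm_le_logd:
  assumes "0 < d" "d < 1"
  shows "harm (nat \<lfloor>8 / d\<rfloor>) \<le> 5 * logd d"
proof -
  let ?N = "nat \<lfloor>8 / d\<rfloor>"
  have "1 \<le> 8 / d" using assms by (simp add: field_simps)
  then have N: "0 < ?N" by simp
  have "harm ?N \<le> 1 + ln (real ?N)" by (rule harm_le_ln[OF N])
  also have "ln (real ?N) \<le> ln (8 / d)"
    using N assms by (intro ln_mono) (auto simp: le_nat_floor)
  also have "ln (8 / d) = 3 * ln 2 + ln (1 / d)"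
  proof -
    have "ln (8 / d) = ln (8::real) + ln (1 / d)" using assms by (simp add: ln_div)
    also have "ln (8::real) = ln (2 ^ 3)" by simp
    also have "\<dots> = 3 * ln (2::real)" by (subst ln_realpow) auto
    finally show ?thesis by simp
  qed
  also have "ln (1 / d) = ln 2 * log 2 (1 / d)" by (simp add: log_def)
  also have "\<dots> \<le> 1 * log 2 (1 / d)"
    using assms ln_2_less_1 by (intro mult_right_mono) auto
  also have "1 + (3 * ln 2 + 1 * log 2 (1 / d)) \<le> 5 * logd d"
    using ln_2_less_1 by linarith
  finally show ?thesis by simp
qed

text \<open>
  Angles are cut into cells of length \<open>r = 40 logd d * d / l\<close>, and one representative is
  chosen in each cell that contains a rich direction. These representatives are divided into 16 classes:
  8 arcs of length 1 (as \<open>2\<pi> < 8\<close>), times 2 parities of the cell index. Inside an arc the sine of the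
  angle difference is comparable to that difference, which also excludes nearly opposite directions.
  Inside a parity class two different cells are never adjacent, so their representatives are separated in
  proportion to the difference of the indices. Hence each class satisfies the hypotheses of
  \<open>card_le_of_small_overlaps\<close>.
\<close>

lemma rich_directions_cover:
  fixes d l :: real
  assumes d: "0 < d" "d < 1" and l: "0 < l" "l \<le> 1" and E: "E \<in> sets lebesgue"
  obtains I :: "nat set" and v :: "nat \<Rightarrow> real^2"
  where "finite I" "\<And>i. norm (v i) = 1"
    "ennreal (card I * (l * d / 2)) \<le> 16 * emeasure lebesgue E"
    "\<And>w T. norm w = 1 \<Longrightarrow> T \<in> tubes d w \<Longrightarrow> ennreal (l * d) \<le> emeasure lebesgue (E \<inter> T)
       \<Longrightarrow> \<exists>i\<in>I. dist (v i) w \<le> 40 * logd d * d / l"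
proof -
  define r where "r = 40 * logd d * d / l"
  have L1: "1 \<le> logd d" by simp
  have rd: "d \<le> r"
  proof -
    have "d * l \<le> d * (40 * logd d)" using d l L1 by (intro mult_left_mono) linarith+
    then show ?thesis using l by (simp add: r_def field_simps)
  qed
  then have r0: "0 < r" using d by simp
  define cell where "cell t = nat \<lfloor>t / r\<rfloor>" for t
  define X where "X = {t. 0 \<le> t \<and> t < 2 * pi \<and>
                     (\<exists>T\<in>tubes d (dir t). ennreal (l * d) \<le> emeasure lebesgue (E \<inter> T))}"
  define N where "N = nat \<lfloor>8 / d\<rfloor>"
  define I where "I = cell ` X"
  define th where "th i = (SOME t. t \<in> X \<and> cell t = i)" for i
  have th: "th i \<in> X" "cell (th i) = i" if "i \<in> I" for i
    using that someI_ex[of "\<lambda>t. t \<in> X \<and> cell t = i"] unfolding I_def th_def by auto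
  have cellb: "real (cell t) * r \<le> t" "t < (real (cell t) + 1) * r" if "0 \<le> t" for t
  proof -
    have "real (cell t) = of_int \<lfloor>t / r\<rfloor>" using that r0 by (simp add: cell_def)
    then have "real (cell t) \<le> t / r" "t / r < real (cell t) + 1" by linarith+
    then show "real (cell t) * r \<le> t" "t < (real (cell t) + 1) * r"
      using r0 by (simp_all add: field_simps)
  qed
  have IN: "i \<le> N" if "i \<in> I" for i
  proof -
    have "0 \<le> th i" "th i < 2 * pi" using th[OF that] by (auto simp: X_def)
    then have "th i \<le> 8" using pi_less_4 by linarith
    then have "th i / r \<le> 8 / d" using \<open>0 \<le> th i\<close> rd d by (intro frac_le) auto
    then have "cell (th i) \<le> N" unfolding cell_def N_def by (intro nat_mono floor_mono)
    then show ?thesis using th[OF that] by simp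
  qed
  have finI: "finite I" using IN by (meson finite_nat_set_iff_bounded_le)
  define T where "T i = (SOME T. T \<in> tubes d (dir (th i)) \<and> ennreal (l * d) \<le> emeasure lebesgue (E \<inter> T))" for i
  have T: "T i \<in> tubes d (dir (th i))" "ennreal (l * d) \<le> emeasure lebesgue (E \<inter> T i)" if "i \<in> I" for i
  proof -
    have "\<exists>T. T \<in> tubes d (dir (th i)) \<and> ennreal (l * d) \<le> emeasure lebesgue (E \<inter> T)"
      using th(1)[OF that] by (auto simp: X_def)
    from someI_ex[OF this]
    show "T i \<in> tubes d (dir (th i))" "ennreal (l * d) \<le> emeasure lebesgue (E \<inter> T i)"
      by (auto simp: T_def)
  qed
  have Tm: "T i \<in> lmeasurable" if "i \<in> I" for i
    using tube_compact[OF T(1)[OF that] d(1)] by (rule lmeasurable_compact)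
  define c where "c i = 2 * nat \<lfloor>th i\<rfloor> + i mod 2" for i
  have c16: "c i < 16" if "i \<in> I" for i
  proof -
    have "0 \<le> th i" "th i < 8" using th[OF that] pi_less_4 by (auto simp: X_def)
    then have "nat \<lfloor>th i\<rfloor> < 8" by linarith
    then show ?thesis unfolding c_def by linarith
  qed
  \<comment> \<open>The factor 4 combines a factor 2 from the separation of cells with a factor 2 from the sine.\<close>
  define b where "b = 4 * d^2 / r"
  have class_bd: "ennreal (card {i\<in>I. c i = k} * (l * d / 2)) \<le> emeasure lebesgue E" for k
  proof (rule card_le_of_small_overlaps[where T = T and b = b and N = N])
    fix i j assume ij: "i \<in> {i\<in>I. c i = k}" "j \<in> {i\<in>I. c i = k}" "j < i"
    then have i: "i \<in> I" and j: "j \<in> I" and cc: "c i = c j" by auto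
    have split: "x mod 2 = y mod 2 \<and> a = b" if "2 * a + x mod 2 = 2 * b + y mod 2" for a b x y :: nat
      using that by presburger
    have "i mod 2 = j mod 2" "nat \<lfloor>th i\<rfloor> = nat \<lfloor>th j\<rfloor>"
      using split[OF cc[unfolded c_def]] by auto
    have ij2: "j + 2 \<le> i" using \<open>i mod 2 = j mod 2\<close> \<open>j < i\<close> by presburger
    have pos: "0 \<le> th i" "0 \<le> th j" using th(1)[OF i] th(1)[OF j] by (auto simp: X_def)
    have near: "\<bar>th j - th i\<bar> \<le> 1"
      using \<open>nat \<lfloor>th i\<rfloor> = nat \<lfloor>th j\<rfloor>\<close> pos by linarith
    have "real (j + 2) \<le> real i" using ij2 by (rule of_nat_mono)
    then have "(real i - real j) / 2 \<le> real i - (real j + 1)" by (simp add: field_simps)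
    then have "(real i - real j) / 2 * r \<le> (real i - (real j + 1)) * r"
      using r0 by (intro mult_right_mono) auto
    also have "\<dots> \<le> \<bar>th j - th i\<bar>"
      using cellb(1)[OF pos(1)] cellb(2)[OF pos(2)] th(2)[OF i] th(2)[OF j]
      by (simp add: left_diff_distrib)
    also have "\<dots> / 2 \<le> \<bar>sin (th j - th i)\<bar>" using abs_sin_ge_half[OF near] .
    finally have sin: "(real i - real j) * r / 4 \<le> \<bar>sin (th j - th i)\<bar>" by simp
    have "measure lebesgue (T i \<inter> T j) * ((real i - real j) * r / 4)
        \<le> measure lebesgue (T i \<inter> T j) * \<bar>sin (th j - th i)\<bar>"
      using sin by (intro mult_left_mono) auto
    also have "\<dots> \<le> d^2" by (rule tube_overlap[OF T(1)[OF i] T(1)[OF j] d(1)])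
    finally have "measure lebesgue (T i \<inter> T j) \<le> b / (real i - real j)"
      using \<open>j < i\<close> r0 by (simp add: b_def field_simps)
    moreover have "T i \<inter> T j \<in> lmeasurable" using Tm i j by (intro fmeasurable.Int)
    ultimately show "emeasure lebesgue (T i \<inter> T j) \<le> ennreal (b / (real i - real j))"
      by (simp add: emeasure_eq_measure2 ennreal_leI)
  next
    have "b = l * d / (10 * logd d)"
      using d l L1 by (simp add: b_def r_def field_simps power2_eq_square)
    then have "b * (5 * logd d) = l * d / 2" using L1 by (simp add: field_simps)
    moreover have "b * harm N \<le> b * (5 * logd d)"
      unfolding N_def using harm_le_logd[OF d] r0 by (intro mult_left_mono) (auto simp: b_def)
    ultimately show "b * harm N \<le> l * d / 2" by linarith
  qed (use finI IN E Tm T(2) d l r0 in \<open>auto simp: b_def\<close>)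
  show ?thesis
  proof (rule that[of I "\<lambda>i. dir (th i)"])
    have "I = (\<Union>k<16. {i\<in>I. c i = k})" using c16 by auto
    then have "card I \<le> (\<Sum>k<16. card {i\<in>I. c i = k})"
      by (metis card_UN_le finite_lessThan)
    then have "real (card I) \<le> (\<Sum>k<16. real (card {i\<in>I. c i = k}))"
      by (metis of_nat_le_iff of_nat_sum)
    then have "real (card I) * (l * d / 2) \<le> (\<Sum>k<16. real (card {i\<in>I. c i = k}) * (l * d / 2))"
      unfolding sum_distrib_right[symmetric] using d l by (intro mult_right_mono) auto
    then have "ennreal (card I * (l * d / 2))
        \<le> (\<Sum>k<16::nat. ennreal (real (card {i\<in>I. c i = k}) * (l * d / 2)))"
      using d l by (subst sum_ennreal) (auto intro!: ennreal_leI)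
    also have "\<dots> \<le> (\<Sum>k<16::nat. emeasure lebesgue E)" using class_bd by (rule sum_mono)
    finally show "ennreal (card I * (l * d / 2)) \<le> 16 * emeasure lebesgue E" by simp
  next
    fix w :: "real^2" and T'
    assume w: "norm w = 1" and T': "T' \<in> tubes d w" "ennreal (l * d) \<le> emeasure lebesgue (E \<inter> T')"
    obtain t where t: "0 \<le> t" "t < 2 * pi" "w = dir t" using dir_surj[OF w] by blast
    then have tX: "t \<in> X" using T' by (auto simp: X_def)
    then have i: "cell t \<in> I" by (auto simp: I_def)
    let ?u = "th (cell t)"
    have "0 \<le> ?u" using th(1)[OF i] by (auto simp: X_def)
    have "\<bar>?u - t\<bar> \<le> r"
      using cellb[OF t(1)] cellb[OF \<open>0 \<le> ?u\<close>] th(2)[OF i] by (simp add: algebra_simps abs_le_iff)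
    then have "dist (dir ?u) w \<le> r" using dist_dir_le[of ?u t] t(3) by simp
    then show "\<exists>i\<in>I. dist (dir (th i)) w \<le> 40 * logd d * d / l" using i by (auto simp: r_def)
  qed (use finI in auto)
qed

text \<open>
  The rich directions are covered by at most \<open>32 e / (l d)\<close> balls of radius \<open>40 logd d * d / l\<close>,
  to which the Frostman condition with exponent \<open>p - 1\<close> applies; \<open>(40 logd d)\<^bsup>p-1\<^esup>\<close> is bounded
  by \<open>40 logd d\<close>. The last conclusion, that for \<open>l \<ge> 1\<close> there is no exceptional set, later
  terminates the sequence of heights.
\<close>

lemma weak_type_set:
  fixes d l e A p :: real and \<mu> :: "(real^2) measure"
  assumes d: "0 < d" "d < 1" and l: "0 < l" and p: "1 \<le> p" "p \<le> 2" and A: "0 \<le> A"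
    and mu: "sets \<mu> = sets (restrict_space borel (sphere 0 1))"
    and frost: "\<And>w r. norm w = 1 \<Longrightarrow> 0 < r \<Longrightarrow>
                  emeasure \<mu> (cball w r \<inter> sphere 0 1) \<le> ennreal (A * r powr (p - 1))"
    and E: "E \<in> sets lebesgue" "emeasure lebesgue E \<le> ennreal e" and e: "0 \<le> e"
  obtains U where "U \<in> sets \<mu>"
    "\<And>w T. norm w = 1 \<Longrightarrow> w \<notin> U \<Longrightarrow> T \<in> tubes d w \<Longrightarrow>
       emeasure lebesgue (E \<inter> T) \<le> ennreal l * emeasure lebesgue T"
    "emeasure \<mu> U \<le> ennreal (1280 * A * logd d * e * d powr (p - 2) * l powr (- p))"
    "1 \<le> l \<Longrightarrow> U = {}"
proof (cases "1 \<le> l")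
  case True
  show ?thesis
  proof (rule that[of "{}"])
    fix w T assume "T \<in> tubes d w"
    then have Tm: "T \<in> sets lebesgue"
      using tube_compact[OF _ d(1)] lmeasurable_compact by blast
    have "emeasure lebesgue (E \<inter> T) \<le> 1 * emeasure lebesgue T"
      unfolding mult_1 using Tm by (intro emeasure_mono) auto
    also have "\<dots> \<le> ennreal l * emeasure lebesgue T"
      using True by (intro mult_right_mono) auto
    finally show "emeasure lebesgue (E \<inter> T) \<le> ennreal l * emeasure lebesgue T" .
  qed auto
next
  case False
  define L where "L = logd d"
  have L1: "1 \<le> L" by (simp add: L_def)
  obtain I :: "nat set" and v where I: "finite I" "\<And>i. norm (v i :: real^2) = 1"
    "ennreal (card I * (l * d / 2)) \<le> 16 * emeasure lebesgue E"
    and cov: "\<And>w T. norm w = 1 \<Longrightarrow> T \<in> tubes d w \<Longrightarrow> ennreal (l * d) \<le> emeasure lebesgue (E \<inter> T)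
       \<Longrightarrow> \<exists>i\<in>I. dist (v i) w \<le> 40 * L * d / l"
    using rich_directions_cover[OF d l _ E(1)] False unfolding L_def by (metis linear)
  define r where "r = 40 * L * d / l"
  have r0: "0 < r" using L1 d l by (simp add: r_def)
  have ballm: "cball w r \<inter> sphere 0 1 \<in> sets \<mu>" for w :: "real^2"
    unfolding mu sets_restrict_space by (auto intro!: image_eqI[of _ _ "cball w r"])
  show ?thesis
  proof (rule that[of "\<Union>i\<in>I. cball (v i) r \<inter> sphere 0 1"])
    show "(\<Union>i\<in>I. cball (v i) r \<inter> sphere 0 1) \<in> sets \<mu>"
      using I(1) ballm by (intro sets.finite_UN)
  next
    fix w T
    assume w: "norm w = 1" "w \<notin> (\<Union>i\<in>I. cball (v i) r \<inter> sphere 0 1)" and T: "T \<in> tubes d w"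
    show "emeasure lebesgue (E \<inter> T) \<le> ennreal l * emeasure lebesgue T"
    proof (rule ccontr)
      assume "\<not> ?thesis"
      then have "ennreal l * emeasure lebesgue T \<le> emeasure lebesgue (E \<inter> T)" by simp
      moreover have "ennreal (l * d) \<le> ennreal l * emeasure lebesgue T"
        using tube_measure_ge[OF T w(1) d(1)] l d by (simp add: ennreal_mult mult_left_mono)
      ultimately have "\<exists>i\<in>I. dist (v i) w \<le> r"
        using cov[OF w(1) T] unfolding r_def by (meson order_trans)
      then show False using w by (auto simp: dist_commute)
    qed
  next
    have "ennreal (card I * (l * d / 2)) \<le> 16 * ennreal e"
      using I(3) E(2) by (meson mult_left_mono order_trans zero_le)
    also have "\<dots> = ennreal (16 * e)" using e by (simp add: ennreal_mult)
    finally have "card I * (l * d / 2) \<le> 16 * e" using e by simp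
    then have card: "real (card I) \<le> 32 * e / (l * d)" using l d by (simp add: field_simps)
    have "emeasure \<mu> (\<Union>i\<in>I. cball (v i) r \<inter> sphere 0 1)
        \<le> (\<Sum>i\<in>I. emeasure \<mu> (cball (v i) r \<inter> sphere 0 1))"
      using I(1) ballm by (intro emeasure_subadditive_finite) auto
    also have "\<dots> \<le> (\<Sum>i\<in>I. ennreal (A * r powr (p - 1)))"
      using frost[OF I(2) r0] by (intro sum_mono)
    also have "\<dots> = ennreal (card I * (A * r powr (p - 1)))"
      using A by (simp add: ennreal_of_nat_eq_real_of_nat flip: ennreal_mult')
    also have "card I * (A * r powr (p - 1)) \<le> 32 * e / (l * d) * (A * (40 * L * (d / l) powr (p - 1)))"
    proof (intro mult_mono card)
      have "r powr (p - 1) = (40 * L) powr (p - 1) * (d / l) powr (p - 1)"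
        using L1 d l by (simp add: r_def powr_mult[symmetric])
      also have "(40 * L) powr (p - 1) \<le> (40 * L) powr 1"
        using L1 p by (intro powr_mono) auto
      finally show "r powr (p - 1) \<le> 40 * L * (d / l) powr (p - 1)"
        using L1 by (simp add: mult_right_mono)
    qed (use A e d l in auto)
    also have "\<dots> = 1280 * A * L * e * ((d / l) powr (p - 1) / (l * d))"
      by simp
    also have "(d / l) powr (p - 1) / (l * d) = d powr (p - 2) * l powr (- p)"
    proof -
      have "(d / l) powr (p - 1) = d powr (p - 1) * l powr (1 - p)"
        using d l by (simp add: powr_divide powr_diff field_simps)
      moreover have "d powr (p - 1) = d powr (p - 2) * d"
        using d by (simp add: powr_diff power2_eq_square field_simps)
      moreover have "l powr (1 - p) = l powr (- p) * l"
        using l by (simp add: powr_diff powr_minus field_simps)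
      ultimately show ?thesis using d l by simp
    qed
    finally show "emeasure \<mu> (\<Union>i\<in>I. cball (v i) r \<inter> sphere 0 1)
        \<le> ennreal (1280 * A * logd d * e * d powr (p - 2) * l powr (- p))"
      by (simp add: L_def ennreal_leI mult.assoc)
  qed (use False in auto)
qed

section \<open>From sets to functions\<close>

lemma dyadic_level:
  assumes "(1::real) \<le> y" "y < 2 ^ n"
  obtains k where "k < n" "2 ^ k \<le> y" "y < 2 ^ Suc k"
  using assms
proof (induction n arbitrary: thesis)
  case (Suc n)
  show ?case
  proof (cases "2 ^ n \<le> y")
    case True
    then show ?thesis using Suc.prems by blast
  next
    case False
    then obtain k where "k < n" "2 ^ k \<le> y" "y < 2 ^ Suc k"
      using Suc.IH Suc.prems by (metis not_le)
    then show ?thesis using Suc.prems(1)[of k] by auto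
  qed
qed auto

lemma kakeya_max_leI:
  assumes "d > 0" "norm w = 1"
    and "\<And>T. T \<in> tubes d w \<Longrightarrow> (\<integral>\<^sup>+y\<in>T. ennreal \<bar>f y\<bar> \<partial>lebesgue) \<le> c * emeasure lebesgue T"
  shows "kakeya_max d f w \<le> c"
  unfolding kakeya_max_def
proof (rule SUP_least)
  fix T assume T: "T \<in> tubes d w"
  have "0 < emeasure lebesgue T"
    using tube_measure_ge[OF T assms(2,1)] assms(1)
    by (metis ennreal_less_zero_iff less_le_trans)
  then show "(\<integral>\<^sup>+y\<in>T. ennreal \<bar>f y\<bar> \<partial>lebesgue) / emeasure lebesgue T \<le> c"
    using assms(3)[OF T] by (intro divide_le_posI_ennreal) (auto simp: mult.commute)
qed

lemma nn_integral_linear_combination: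
  assumes "A \<in> sets M" "\<And>k. B k \<in> sets M" "g \<in> borel_measurable M"
  shows "(\<integral>\<^sup>+y. indicator A y + (\<Sum>k<n. c k * indicator (B k) y) + c' * g y \<partial>M)
    = emeasure M A + (\<Sum>k<(n::nat). c k * emeasure M (B k)) + c' * (\<integral>\<^sup>+y. g y \<partial>M)"
proof -
  note [simp del] = sum_mult_indicator
  show ?thesis
    using assms by (simp add: nn_integral_add nn_integral_sum nn_integral_cmult)
qed

text \<open>
  The sets \<open>E k\<close> below are the dyadic levels \<open>2\<^sup>k \<le> |f| < 2\<^bsup>k+1\<^esup>\<close> for \<open>k < n\<close>. By Chebyshev
  \<open>|E k| \<le> 2\<^bsup>-kp\<^esup>\<close>. To control \<open>2\<^sup>k\<close> times the average of the indicator function of \<open>E k\<close> at height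
  \<open>2\<^sup>j \<beta>\<close>, the weak-type estimate is used with \<open>l = 2\<^sup>j \<beta> / 2\<^sup>k\<close>, and then all dependence on \<open>k\<close>
  cancels from the measure of the exceptional set. The condition on \<open>n\<close> makes \<open>2\<^sup>n \<ge> d\<^bsup>-2\<^esup>\<close>. At
  height \<open>2\<^sup>n \<beta>\<close> the exceptional set is empty, since the averages of indicator functions are at most 1.
\<close>

lemma weak_type_function:
  fixes d A p :: real and \<mu> :: "(real^2) measure"
  assumes d: "0 < d" "d < 1" and p: "1 \<le> p" "p \<le> 2" and A: "0 \<le> A"
    and mu: "sets \<mu> = sets (restrict_space borel (sphere 0 1))"
    and frost: "\<And>w r. norm w = 1 \<Longrightarrow> 0 < r \<Longrightarrow>
                  emeasure \<mu> (cball w r \<inter> sphere 0 1) \<le> ennreal (A * r powr (p - 1))"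
    and f [measurable]: "f \<in> borel_measurable lebesgue"
    and int: "(\<integral>\<^sup>+x. ennreal (\<bar>f x\<bar> powr p) \<partial>lebesgue) \<le> 1"
    and n: "2 * logd d \<le> real n"
  obtains V :: "nat \<Rightarrow> (real^2) set"
  where "\<And>j. V j \<in> sets \<mu>" "V n = {}"
    "\<And>j w. norm w = 1 \<Longrightarrow> w \<notin> V j \<Longrightarrow>
       kakeya_max d f w \<le> ennreal (4 * real n * d powr (1 - 2 / p) * 2 ^ j)"
    "\<And>j. emeasure \<mu> (V j) \<le> ennreal (1280 * A * real n * logd d * 2 powr (- (j * p)))"
proof -
  define L where "L = logd d"
  define \<beta> where "\<beta> = d powr (1 - 2 / p)"
  have L1: "1 \<le> L" by (simp add: L_def)
  have \<beta>1: "1 \<le> \<beta>"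
  proof -
    have "1 - 2 / p \<le> 0" using p by (simp add: field_simps)
    then show ?thesis unfolding \<beta>_def using d powr_mono'[of "1 - 2 / p" 0 d] by simp
  qed
  have \<beta>p: "\<beta> powr p = d powr (p - 2)"
  proof -
    have "(1 - 2 / p) * p = p - 2" using p by (simp add: left_diff_distrib)
    then show ?thesis by (simp add: \<beta>_def powr_powr)
  qed
  have n1: "1 \<le> n" using n by linarith
  define E where "E k = {x. 2 ^ k \<le> \<bar>f x\<bar> \<and> \<bar>f x\<bar> < 2 ^ Suc k}" for k :: nat
  have Em [measurable]: "E k \<in> sets lebesgue" for k
  proof -
    have "E k = {x\<in>space lebesgue. 2 ^ k \<le> \<bar>f x\<bar> \<and> \<bar>f x\<bar> < 2 ^ Suc k}" by (simp add: E_def)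
    also have "\<dots> \<in> sets lebesgue" by measurable
    finally show ?thesis .
  qed
  have Ee: "emeasure lebesgue (E k) \<le> ennreal (2 powr (- (k * p)))" for k
  proof -
    have "emeasure lebesgue (E k) = (\<integral>\<^sup>+x. indicator (E k) x \<partial>lebesgue)"
      using Em by (simp only: nn_integral_indicator)
    also have "\<dots> \<le> (\<integral>\<^sup>+x. ennreal (2 powr (- (k * p))) * ennreal (\<bar>f x\<bar> powr p) \<partial>lebesgue)"
    proof (rule nn_integral_mono)
      fix x
      show "indicator (E k) x \<le> ennreal (2 powr (- (k * p))) * ennreal (\<bar>f x\<bar> powr p)"
      proof (cases "x \<in> E k")
        case True
        then have "2 ^ k \<le> \<bar>f x\<bar>" by (simp add: E_def)
        then have "(2 ^ k) powr p \<le> \<bar>f x\<bar> powr p" using p by (intro powr_mono2) auto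
        then have "2 powr (- (k * p)) * (2 powr (k * p)) \<le> 2 powr (- (k * p)) * \<bar>f x\<bar> powr p"
          by (intro mult_left_mono) (auto simp: powr_powr simp flip: powr_realpow)
        then have "1 \<le> 2 powr (- (k * p)) * \<bar>f x\<bar> powr p" by (simp flip: powr_add)
        then show ?thesis using True by (simp flip: ennreal_mult)
      qed simp
    qed
    also have "\<dots> = ennreal (2 powr (- (k * p))) * (\<integral>\<^sup>+x. ennreal (\<bar>f x\<bar> powr p) \<partial>lebesgue)"
      by (rule nn_integral_cmult) measurable
    also have "\<dots> \<le> ennreal (2 powr (- (k * p))) * 1" using int by (rule mult_left_mono) simp
    finally show ?thesis by simp
  qed
  have "\<exists>U. U \<in> sets \<mu> \<and>
      (\<forall>w T. norm w = 1 \<longrightarrow> w \<notin> U \<longrightarrow> T \<in> tubes d w \<longrightarrow>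
         emeasure lebesgue (E k \<inter> T) \<le> ennreal (2 ^ j * \<beta> / 2 ^ k) * emeasure lebesgue T) \<and>
      emeasure \<mu> U \<le> ennreal (1280 * A * L * 2 powr (- (j * p))) \<and>
      (1 \<le> 2 ^ j * \<beta> / 2 ^ k \<longrightarrow> U = {})" for k j :: nat
  proof -
    define l where "l = 2 ^ j * \<beta> / 2 ^ k"
    have l0: "0 < l" using \<beta>1 by (simp add: l_def)
    have "2 powr (- (k * p)) * d powr (p - 2) * l powr (- p) = 2 powr (- (j * p))"
    proof -
      have "l powr (- p) = 2 powr (- (j * p)) * \<beta> powr (- p) / 2 powr (- (k * p))"
        using \<beta>1 by (simp add: l_def powr_divide powr_mult powr_powr flip: powr_realpow)
      also have "\<beta> powr (- p) = 1 / d powr (p - 2)" using \<beta>p by (simp add: powr_minus_divide)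
      finally show ?thesis using d by simp
    qed
    then have eq: "1280 * A * L * 2 powr (- (k * p)) * d powr (p - 2) * l powr (- p)
        = 1280 * A * L * 2 powr (- (j * p))" by (simp add: mult.assoc)
    obtain U where "U \<in> sets \<mu>"
      "\<And>w T. norm w = 1 \<Longrightarrow> w \<notin> U \<Longrightarrow> T \<in> tubes d w \<Longrightarrow>
         emeasure lebesgue (E k \<inter> T) \<le> ennreal l * emeasure lebesgue T"
      "emeasure \<mu> U \<le> ennreal (1280 * A * L * 2 powr (- (k * p)) * d powr (p - 2) * l powr (- p))"
      "1 \<le> l \<Longrightarrow> U = {}"
      using weak_type_set[OF d l0 p A mu frost Em Ee, of k] unfolding L_def by auto
    then show ?thesis unfolding eq unfolding l_def by blast
  qed
  then obtain U where U: "\<And>k j. U k j \<in> sets \<mu>"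
    "\<And>k j w T. norm w = 1 \<Longrightarrow> w \<notin> U k j \<Longrightarrow> T \<in> tubes d w \<Longrightarrow>
       emeasure lebesgue (E k \<inter> T) \<le> ennreal (2 ^ j * \<beta> / 2 ^ k) * emeasure lebesgue T"
    "\<And>k j. emeasure \<mu> (U k j) \<le> ennreal (1280 * A * L * 2 powr (- (real j * p)))"
    "\<And>k j. 1 \<le> 2 ^ j * \<beta> / 2 ^ k \<Longrightarrow> U k j = {}"
    by metis
  define V where "V j = (\<Union>k<n. U k j)" for j
  \<comment> \<open>On \<open>|f| \<ge> 2\<^sup>n\<close> one has \<open>|f| \<le> (2\<^sup>n)\<^bsup>1-p\<^esup> |f|\<^sup>p\<close>, so this bounds the integral of the tall part of \<open>f\<close>.\<close>
  have tail: "(2 ^ n) powr (1 - p) \<le> d * \<beta>"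
  proof -
    have "1 / d = 2 powr (log 2 (1 / d))" using d by simp
    also have "\<dots> \<le> 2 powr L" by (intro powr_mono) (auto simp: L_def)
    finally have "(1 / d) powr 2 \<le> (2 powr L) powr 2" using d by (intro powr_mono2) auto
    also have "\<dots> \<le> 2 powr n" using n by (simp add: powr_powr L_def mult.commute)
    finally have "(1 / d) powr 2 \<le> 2 ^ n" by (simp add: powr_realpow)
    then have "(2 ^ n) powr (1 - p) \<le> ((1 / d) powr 2) powr (1 - p)"
      using p d by (intro powr_mono2') auto
    also have "\<dots> = d powr (2 * (p - 1))"
    proof -
      have "1 / d = d powr (- 1)" using d by (simp add: powr_minus_divide)
      then show ?thesis by (simp only: powr_powr) (simp add: algebra_simps)
    qed
    also have "\<dots> \<le> d powr (1 + (1 - 2 / p))"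
    proof (rule powr_mono')
      have "1 * (p - 1) \<le> p * (p - 1)" using p by (intro mult_right_mono) auto
      then show "1 + (1 - 2 / p) \<le> 2 * (p - 1)" using p by (simp add: field_simps)
    qed (use d in auto)
    also have "\<dots> = d * \<beta>" unfolding \<beta>_def using d by (subst powr_add) simp
    finally show ?thesis .
  qed
  show ?thesis
  proof (rule that[of V])
    show "V j \<in> sets \<mu>" for j unfolding V_def using U(1) by (intro sets.finite_UN) auto
  next
    have "U k n = {}" if "k < n" for k
    proof (rule U(4))
      have "(2::real) ^ k * 1 \<le> 2 ^ n * \<beta>" using that \<beta>1 by (intro mult_mono) auto
      then show "1 \<le> 2 ^ n * \<beta> / 2 ^ k" by (simp add: field_simps)
    qed
    then show "V n = {}" by (simp add: V_def)
  next
    fix j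
    have "emeasure \<mu> (V j) \<le> (\<Sum>k<n. emeasure \<mu> (U k j))"
      unfolding V_def using U(1) by (intro emeasure_subadditive_finite) auto
    also have "\<dots> \<le> (\<Sum>k<n. ennreal (1280 * A * L * 2 powr (- (j * p))))"
      using U(3) by (rule sum_mono)
    also have "\<dots> = ennreal (n * (1280 * A * L * 2 powr (- (j * p))))"
      using A L1 by (simp add: ennreal_of_nat_eq_real_of_nat flip: ennreal_mult')
    finally show "emeasure \<mu> (V j) \<le> ennreal (1280 * A * real n * logd d * 2 powr (- (j * p)))"
      by (simp add: L_def mult_ac)
  next
    fix j and w :: "real^2" assume w: "norm w = 1" "w \<notin> V j"
    have "kakeya_max d f w \<le> ennreal (4 * real n * \<beta> * 2 ^ j)"
    proof (rule kakeya_max_leI[OF d(1) w(1)])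
      fix T assume T: "T \<in> tubes d w"
      have Tl: "T \<in> lmeasurable" using tube_compact[OF T d(1)] by (rule lmeasurable_compact)
      then have Tm [measurable]: "T \<in> sets lebesgue" by (rule fmeasurableD)
      define m where "m = measure lebesgue T"
      have m: "emeasure lebesgue T = ennreal m" using Tl by (simp add: m_def emeasure_eq_measure2)
      have m0: "0 \<le> m" by (simp add: m_def)
      have dm: "d \<le> m" using tube_measure_ge[OF T w(1) d(1)] m m0 by simp
      have "(\<integral>\<^sup>+y\<in>T. ennreal \<bar>f y\<bar> \<partial>lebesgue)
        \<le> (\<integral>\<^sup>+y. indicator T y + (\<Sum>k<n. ennreal (2 ^ Suc k) * indicator (E k \<inter> T) y)
             + ennreal ((2 ^ n) powr (1 - p)) * ennreal (\<bar>f y\<bar> powr p) \<partial>lebesgue)"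
      proof (rule nn_integral_mono)
        fix y
        let ?a = "indicator T y :: ennreal"
          and ?b = "(\<Sum>k<n. ennreal (2 ^ Suc k) * indicator (E k \<inter> T) y)"
          and ?c = "ennreal ((2 ^ n) powr (1 - p)) * ennreal (\<bar>f y\<bar> powr p)"
        have "ennreal \<bar>f y\<bar> * indicator T y \<le> ?a \<or> ennreal \<bar>f y\<bar> * indicator T y \<le> ?b
            \<or> ennreal \<bar>f y\<bar> * indicator T y \<le> ?c"
        proof (cases "y \<in> T")
          case True
          consider "\<bar>f y\<bar> \<le> 1" | "1 \<le> \<bar>f y\<bar>" "\<bar>f y\<bar> < 2 ^ n" | "2 ^ n \<le> \<bar>f y\<bar>" by linarith
          then show ?thesis
          proof cases
            case 1
            then show ?thesis using True by simp
          next
            case 2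
            then obtain k where k: "k < n" "2 ^ k \<le> \<bar>f y\<bar>" "\<bar>f y\<bar> < 2 ^ Suc k"
              using dyadic_level by blast
            then have "ennreal \<bar>f y\<bar> * indicator T y \<le> ennreal (2 ^ Suc k) * indicator (E k \<inter> T) y"
              using True by (auto simp: E_def intro!: ennreal_leI)
            also have "\<dots> \<le> ?b" using k(1) by (intro member_le_sum) auto
            finally show ?thesis by blast
          next
            case 3
            then have "\<bar>f y\<bar> powr (1 - p) \<le> (2 ^ n) powr (1 - p)"
              using p by (intro powr_mono2') auto
            then have "\<bar>f y\<bar> powr (1 - p) * \<bar>f y\<bar> powr p \<le> (2 ^ n) powr (1 - p) * \<bar>f y\<bar> powr p"
              by (intro mult_right_mono) auto
            moreover have "\<bar>f y\<bar> powr (1 - p) * \<bar>f y\<bar> powr p = \<bar>f y\<bar>"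
              by (simp flip: powr_add)
            ultimately have "ennreal \<bar>f y\<bar> \<le> ?c" by (simp add: ennreal_leI flip: ennreal_mult)
            then show ?thesis using True by simp
          qed
        qed simp
        moreover have "?a \<le> ?a + ?b + ?c" "?b \<le> ?a + ?b + ?c" "?c \<le> ?a + ?b + ?c"
          by (auto simp: add_increasing add_increasing2 add.assoc)
        ultimately show "ennreal \<bar>f y\<bar> * indicator T y \<le> ?a + ?b + ?c" by (meson order_trans)
      qed
      also have "\<dots> = emeasure lebesgue T + (\<Sum>k<n. ennreal (2 ^ Suc k) * emeasure lebesgue (E k \<inter> T))
             + ennreal ((2 ^ n) powr (1 - p)) * (\<integral>\<^sup>+y. ennreal (\<bar>f y\<bar> powr p) \<partial>lebesgue)"
      proof -
        have "E k \<inter> T \<in> sets lebesgue" for k using Em Tm by (rule sets.Int)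
        moreover have "(\<lambda>y. ennreal (\<bar>f y\<bar> powr p)) \<in> borel_measurable lebesgue" by measurable
        ultimately show ?thesis using Tm by (intro nn_integral_linear_combination)
      qed
      also have "\<dots> \<le> ennreal m + (\<Sum>k<n. ennreal (2 ^ Suc k) * ennreal (2 ^ j * \<beta> / 2 ^ k * m))
             + ennreal (d * \<beta>) * 1"
      proof (intro add_mono mult_mono sum_mono ennreal_leI tail int)
        fix k assume "k \<in> {..<n}"
        then have "w \<notin> U k j" using w(2) by (auto simp: V_def)
        from U(2)[OF w(1) this T] show "emeasure lebesgue (E k \<inter> T) \<le> ennreal (2 ^ j * \<beta> / 2 ^ k * m)"
          unfolding m using m0 \<beta>1 by (subst ennreal_mult) auto
      qed (use m in auto)
      also have "\<dots> = ennreal (m + (\<Sum>k<n. 2 ^ Suc k * (2 ^ j * \<beta> / 2 ^ k * m)) + d * \<beta>)"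
        using m0 \<beta>1 d by (simp add: ennreal_of_nat_eq_real_of_nat flip: ennreal_mult ennreal_plus)
      also have "(\<Sum>k<n. 2 ^ Suc k * (2 ^ j * \<beta> / 2 ^ k * m)) = n * (2 * (2 ^ j * \<beta>) * m)"
        by simp
      also have "ennreal (m + n * (2 * (2 ^ j * \<beta>) * m) + d * \<beta>) \<le> ennreal (4 * real n * \<beta> * 2 ^ j * m)"
      proof (rule ennreal_leI)
        have x: "\<beta> \<le> n * (2 ^ j * \<beta>)"
        proof -
          have "1 * (1 * \<beta>) \<le> n * (2 ^ j * \<beta>)" using n1 \<beta>1 by (intro mult_mono) auto
          then show ?thesis by simp
        qed
        have "m \<le> n * (2 ^ j * \<beta>) * m" using mult_right_mono[of 1 "n * (2 ^ j * \<beta>)" m] x \<beta>1 m0 by auto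
        moreover have "d * \<beta> \<le> m * (n * (2 ^ j * \<beta>))" using dm x d \<beta>1 by (intro mult_mono) auto
        ultimately show "m + n * (2 * (2 ^ j * \<beta>) * m) + d * \<beta> \<le> 4 * real n * \<beta> * 2 ^ j * m"
          by (simp add: mult_ac)
      qed
      also have "\<dots> = ennreal (4 * real n * \<beta> * 2 ^ j) * emeasure lebesgue T"
        using m0 \<beta>1 by (simp add: m ennreal_mult)
      finally show "(\<integral>\<^sup>+y\<in>T. ennreal \<bar>f y\<bar> \<partial>lebesgue)
          \<le> ennreal (4 * real n * \<beta> * 2 ^ j) * emeasure lebesgue T" .
    qed
    then show "kakeya_max d f w \<le> ennreal (4 * real n * d powr (1 - 2 / p) * 2 ^ j)" by (simp add: \<beta>_def)
  qed
qed

section \<open>The strong-type estimate\<close>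

lemma epowr_ennreal [simp]: "0 \<le> x \<Longrightarrow> epowr (ennreal x) p = ennreal (x powr p)"
  by (simp add: epowr_def)

lemma epowr_mono:
  assumes "x \<le> y" "0 \<le> p"
  shows "epowr x p \<le> epowr y p"
proof (cases "y = \<infinity>")
  case False
  then have "x \<noteq> \<infinity>" using assms(1) by (auto simp: top_unique)
  have "enn2real x \<le> enn2real y"
    using assms(1) False by (intro enn2real_mono) (auto simp: less_top)
  then show ?thesis
    using False \<open>x \<noteq> \<infinity>\<close> assms(2) by (auto simp: epowr_def intro!: ennreal_leI powr_mono2)
qed (simp add: epowr_def)

lemma kakeya_max_rescale:
  assumes F: "0 < F" and f: "f \<in> borel_measurable lebesgue"
  shows "kakeya_max d f w \<le> ennreal F * kakeya_max d (\<lambda>x. f x / F) w"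
  unfolding kakeya_max_def
proof (rule SUP_least)
  fix T assume T: "T \<in> tubes d w"
  let ?I = "\<lambda>f T. \<integral>\<^sup>+y\<in>T. ennreal \<bar>f y\<bar> \<partial>lebesgue"
  have Tm: "T \<in> sets lebesgue"
  proof -
    have "closed T"
      using T by (auto simp: tubes_def intro!: closed_Collect_le continuous_intros)
    then show ?thesis by auto
  qed
  have "?I f T = (\<integral>\<^sup>+y. ennreal F * (ennreal \<bar>f y / F\<bar> * indicator T y) \<partial>lebesgue)"
    using F by (intro nn_integral_cong) (auto simp: abs_divide simp flip: ennreal_mult mult.assoc)
  also have "\<dots> = ennreal F * ?I (\<lambda>x. f x / F) T"
    using f Tm by (intro nn_integral_cmult) auto
  finally have "?I f T / emeasure lebesgue T = ennreal F * (?I (\<lambda>x. f x / F) T / emeasure lebesgue T)"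
    by (simp add: ennreal_times_divide)
  also have "\<dots> \<le> ennreal F * (SUP T\<in>tubes d w. ?I (\<lambda>x. f x / F) T / emeasure lebesgue T)"
    using T by (intro mult_left_mono SUP_upper) auto
  finally show "?I f T / emeasure lebesgue T
      \<le> ennreal F * (SUP T\<in>tubes d w. ?I (\<lambda>x. f x / F) T / emeasure lebesgue T)" .
qed

lemma L1_loc_measurable:
  assumes "L1_loc f"
  shows "f \<in> borel_measurable lebesgue"
proof (rule borel_measurable_LIMSEQ_real)
  fix x :: "real^2"
  show "(\<lambda>i. indicator (cball 0 (real i)) x *\<^sub>R f x) \<longlonglongrightarrow> f x"
  proof (rule tendsto_eventually)
    have "indicator (cball 0 (real i)) x *\<^sub>R f x = f x" if "nat \<lceil>norm x\<rceil> \<le> i" for i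
      using that by (auto simp: indicator_def)
    then show "\<forall>\<^sub>F i in sequentially. indicator (cball 0 (real i)) x *\<^sub>R f x = f x"
      unfolding eventually_sequentially by blast
  qed
next
  fix i :: nat
  have "set_integrable lebesgue (cball 0 (real i)) f" using assms by (simp add: L1_loc_def)
  then show "(\<lambda>x. indicator (cball 0 (real i)) x *\<^sub>R f x) \<in> borel_measurable lebesgue"
    unfolding set_integrable_def by (rule borel_measurable_integrable)
qed

text \<open>
  Radii above 2 may be replaced by 2, the diameter of the circle, and for \<open>q \<le> 2\<close> one has
  \<open>q\<^sup>s = q\<^bsup>s-t\<^esup> q\<^sup>t \<le> 2 q\<^sup>t\<close>.
\<close>

lemma frostman_lower_exponent:
  assumes mu: "frostman_with A s \<mu>" and s: "0 \<le> t" "t \<le> s" "s \<le> 1" and A: "0 < A"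
    and w: "norm w = 1" and r: "0 < r"
  shows "emeasure \<mu> (cball w r \<inter> sphere 0 1) \<le> ennreal (2 * A * r powr t)"
proof -
  have frost: "emeasure \<mu> (cball w r \<inter> sphere 0 1) \<le> ennreal (A * r powr s)" if "0 < r" for r
    using mu that w by (auto simp: frostman_with_def)
  define q where "q = min r 2"
  have q: "0 < q" "q \<le> 2" "q \<le> r" using r by (auto simp: q_def)
  have "dist w y \<le> 2" if "norm y = 1" for y
    using norm_triangle_ineq4[of w y] w that by (simp add: dist_norm)
  then have "cball w r \<inter> sphere 0 1 = cball w q \<inter> sphere 0 1" by (auto simp: q_def)
  then have "emeasure \<mu> (cball w r \<inter> sphere 0 1) \<le> ennreal (A * q powr s)"
    using frost[OF q(1)] by simp
  also have "\<dots> \<le> ennreal (2 * A * r powr t)"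
  proof (rule ennreal_leI)
    have "q powr s = q powr (s - t) * q powr t" by (simp flip: powr_add)
    also have "q powr (s - t) \<le> 2 powr (s - t)" using q s by (intro powr_mono2) auto
    also have "(2::real) powr (s - t) \<le> 2 powr 1" using s by (intro powr_mono) auto
    also have "q powr t \<le> r powr t" using q s by (intro powr_mono2) auto
    finally have "q powr s \<le> 2 * r powr t" by (simp add: mult_left_mono mult_right_mono)
    then show "A * q powr s \<le> 2 * A * r powr t" using A by simp
  qed
  finally show ?thesis .
qed

text \<open>
  For a direction \<open>w\<close> let \<open>j\<close> be the first height whose exceptional set \<open>V j\<close> omits \<open>w\<close>. Then the
  maximal function at \<open>w\<close> is at most \<open>D 2\<^sup>j\<close>, and \<open>w \<in> V (j - 1)\<close> unless \<open>j = 0\<close>. So its \<open>p\<close>-th power is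
  dominated by a simple function \<open>G\<close>, in whose integral the factors \<open>2\<^bsup>jp\<^esup>\<close> and \<open>2\<^bsup>-jp\<^esup>\<close> cancel in
  each of the \<open>n\<close> terms. The number \<open>F\<close> is any positive upper bound for the norm of \<open>f\<close>, so that
  functions with norm 0 need no separate treatment.
\<close>

lemma strong_type:
  fixes d A p F :: real and \<mu> :: "(real^2) measure"
  assumes d: "0 < d" "d < 1" and p: "1 \<le> p" "p \<le> 2" and A: "1 \<le> A"
    and mu: "sets \<mu> = sets (restrict_space borel (sphere 0 1))"
    and frost: "\<And>w r. norm w = 1 \<Longrightarrow> 0 < r \<Longrightarrow>
                  emeasure \<mu> (cball w r \<inter> sphere 0 1) \<le> ennreal (A * r powr (p - 1))"
    and f [measurable]: "f \<in> borel_measurable lebesgue" and F: "0 < F"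
    and int: "(\<integral>\<^sup>+x. ennreal (\<bar>f x\<bar> powr p) \<partial>lebesgue) \<le> ennreal (F powr p)"
  shows "Lp_norm \<mu> p (kakeya_max d f)
    \<le> ennreal (2 * 10 ^ 6 * A * logd d ^ 4 * d powr (1 - 2 / p) * F)"
proof -
  define L where "L = logd d"
  have L1: "1 \<le> L" by (simp add: L_def)
  define \<beta> where "\<beta> = d powr (1 - 2 / p)"
  have \<beta>0: "0 < \<beta>" using d by (simp add: \<beta>_def)
  define n where "n = nat \<lceil>2 * L\<rceil>"
  have n: "2 * L \<le> real n" "real n \<le> 3 * L" using L1 unfolding n_def by linarith+
  define D where "D = 4 * real n * \<beta> * F"
  have D0: "0 < D" using n L1 \<beta>0 F by (simp add: D_def)
  have "(\<integral>\<^sup>+x. ennreal (\<bar>f x / F\<bar> powr p) \<partial>lebesgue)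
      = (\<integral>\<^sup>+x. ennreal (1 / F powr p) * ennreal (\<bar>f x\<bar> powr p) \<partial>lebesgue)"
    using F by (intro nn_integral_cong) (simp add: powr_divide flip: ennreal_mult)
  also have "\<dots> = ennreal (1 / F powr p) * (\<integral>\<^sup>+x. ennreal (\<bar>f x\<bar> powr p) \<partial>lebesgue)"
    by (rule nn_integral_cmult) measurable
  also have "\<dots> \<le> ennreal (1 / F powr p) * ennreal (F powr p)" using int by (rule mult_left_mono) simp
  also have "\<dots> = 1" using F by (simp flip: ennreal_mult)
  finally have int': "(\<integral>\<^sup>+x. ennreal (\<bar>f x / F\<bar> powr p) \<partial>lebesgue) \<le> 1" .
  have f': "(\<lambda>x. f x / F) \<in> borel_measurable lebesgue" by measurable
  have A0: "0 \<le> A" using A by simp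
  obtain V where V: "\<And>j. V j \<in> sets \<mu>" "V n = {}"
    "\<And>j w. norm w = 1 \<Longrightarrow> w \<notin> V j \<Longrightarrow>
       kakeya_max d (\<lambda>x. f x / F) w \<le> ennreal (4 * real n * \<beta> * 2 ^ j)"
    "\<And>j. emeasure \<mu> (V j) \<le> ennreal (1280 * A * real n * L * 2 powr (- (j * p)))"
    using weak_type_function[OF d p A0 mu frost f' int' n(1)[unfolded L_def]]
    unfolding \<beta>_def L_def by blast
  have K: "epowr (kakeya_max d f w) p \<le> ennreal (D powr p * 2 powr (j * p))"
    if "norm w = 1" "w \<notin> V j" for w j
  proof -
    have "kakeya_max d f w \<le> ennreal F * kakeya_max d (\<lambda>x. f x / F) w"
      by (rule kakeya_max_rescale[OF F f])
    also have "\<dots> \<le> ennreal F * ennreal (4 * real n * \<beta> * 2 ^ j)"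
      using V(3)[OF that] by (rule mult_left_mono) simp
    also have "\<dots> = ennreal (D * 2 ^ j)"
      unfolding D_def using F \<beta>0 by (subst ennreal_mult[symmetric]) (auto simp: mult_ac)
    finally have "epowr (kakeya_max d f w) p \<le> epowr (ennreal (D * 2 ^ j)) p"
      using p by (intro epowr_mono) auto
    also have "\<dots> = ennreal (D powr p * 2 powr (j * p))"
      using D0 by (simp add: powr_mult powr_powr flip: powr_realpow)
    finally show ?thesis .
  qed
  have space: "space \<mu> = sphere 0 1"
    using sets_eq_imp_space_eq[OF mu] by (simp add: space_restrict_space)
  define G where "G w = ennreal (D powr p) *
     (1 + (\<Sum>j<n. ennreal (2 powr (Suc j * p)) * indicator (V j) w))" for w
  have KG: "epowr (kakeya_max d f w) p \<le> G w" if "w \<in> space \<mu>" for w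
  proof -
    have w: "norm w = 1" using that space by simp
    define j where "j = (LEAST j. w \<notin> V j)"
    have wn: "w \<notin> V n" by (simp add: V(2))
    have wj: "w \<notin> V j" unfolding j_def using wn by (rule LeastI)
    have jn: "j \<le> n" unfolding j_def using wn by (rule Least_le)
    have "ennreal (2 powr (j * p)) \<le> 1 + (\<Sum>j<n. ennreal (2 powr (Suc j * p)) * indicator (V j) w)"
    proof (cases j)
      case (Suc i)
      then have "w \<in> V i" using not_less_Least[of i "\<lambda>j. w \<notin> V j"] unfolding j_def by auto
      then have "ennreal (2 powr (j * p)) = ennreal (2 powr (Suc i * p)) * indicator (V i) w"
        using Suc by simp
      also have "\<dots> \<le> (\<Sum>j<n. ennreal (2 powr (Suc j * p)) * indicator (V j) w)"
        using jn Suc by (intro member_le_sum) auto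
      finally show ?thesis by (simp add: add_increasing)
    qed simp
    then have "ennreal (D powr p) * ennreal (2 powr (j * p)) \<le> G w"
      unfolding G_def by (rule mult_left_mono) simp
    then show ?thesis using K[OF w wj] by (simp add: ennreal_mult)
  qed
  have total: "emeasure \<mu> (space \<mu>) \<le> ennreal (2 * A)"
  proof -
    have "norm (dir 0) = 1" by simp
    have "dist (dir 0) y \<le> 2" if "norm y = 1" for y
      using norm_triangle_ineq4[of "dir 0" y] that by (simp add: dist_norm)
    then have "space \<mu> = cball (dir 0) 2 \<inter> sphere 0 1" using space by auto
    then have "emeasure \<mu> (space \<mu>) \<le> ennreal (A * 2 powr (p - 1))"
      using frost[of "dir 0" 2] by simp
    also have "\<dots> \<le> ennreal (2 * A)"
    proof (rule ennreal_leI)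
      have "(2::real) powr (p - 1) \<le> 2 powr 1" using p by (intro powr_mono) auto
      then show "A * 2 powr (p - 1) \<le> 2 * A" using A0 mult_left_mono by fastforce
    qed
    finally show ?thesis .
  qed
  define B where "B = 10 ^ 5 * A * L ^ 3"
  have B1: "1 \<le> B"
  proof -
    have "1 * 1 * 1 \<le> B" unfolding B_def using A L1 by (intro mult_mono one_le_power) auto
    then show ?thesis by simp
  qed
  have "(\<integral>\<^sup>+w. epowr (kakeya_max d f w) p \<partial>\<mu>) \<le> (\<integral>\<^sup>+w. G w \<partial>\<mu>)"
    using KG by (rule nn_integral_mono)
  also have "\<dots> = ennreal (D powr p) *
      (emeasure \<mu> (space \<mu>) + (\<Sum>j<n. ennreal (2 powr (Suc j * p)) * emeasure \<mu> (V j)))"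
  proof -
    note [simp del] = sum_mult_indicator
    show ?thesis
      unfolding G_def using V(1) by (simp add: nn_integral_add nn_integral_sum nn_integral_cmult)
  qed
  also have "\<dots> \<le> ennreal (D powr p) * (ennreal (2 * A) + (\<Sum>j<n. ennreal (5120 * A * n * L)))"
  proof (intro mult_left_mono add_mono total sum_mono)
    fix j
    have "ennreal (2 powr (Suc j * p)) * emeasure \<mu> (V j)
       \<le> ennreal (2 powr (Suc j * p)) * ennreal (1280 * A * real n * L * 2 powr (- (j * p)))"
      using V(4) by (rule mult_left_mono) simp
    also have "\<dots> = ennreal (2 powr (Suc j * p) * (1280 * A * real n * L * 2 powr (- (j * p))))"
      using A0 L1 by (subst ennreal_mult) auto
    also have "2 powr (Suc j * p) * (1280 * A * real n * L * 2 powr (- (j * p)))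
        = 1280 * A * real n * L * 2 powr p"
    proof -
      have "2 powr (Suc j * p) * 2 powr (- (j * p)) = (2::real) powr p"
        unfolding powr_add[symmetric] by (simp add: algebra_simps)
      then show ?thesis by (metis mult.assoc mult.commute)
    qed
    also have "1280 * A * real n * L * 2 powr p \<le> 1280 * A * real n * L * 2 powr 2"
      using A0 L1 p by (intro mult_left_mono powr_mono) auto
    finally show "ennreal (2 powr (Suc j * p)) * emeasure \<mu> (V j) \<le> ennreal (5120 * A * n * L)"
      using A0 L1 by (simp add: ennreal_leI order_trans)
  qed simp
  also have "\<dots> = ennreal (D powr p * (2 * A + n * (5120 * A * n * L)))"
    using A0 L1 by (simp add: ennreal_of_nat_eq_real_of_nat flip: ennreal_mult ennreal_plus)
  also have "\<dots> \<le> ennreal (D powr p * B)"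
  proof (intro ennreal_leI mult_left_mono)
    have "real n * real n \<le> (3 * L) * (3 * L)" using n by (intro mult_mono) auto
    then have "5120 * A * L * (real n * real n) \<le> 5120 * A * L * (9 * L^2)"
      using A0 L1 by (intro mult_left_mono) (auto simp: power2_eq_square)
    moreover have "A * 1 \<le> A * L ^ 3" using A0 L1 by (intro mult_left_mono one_le_power) auto
    moreover have "5120 * A * L * (9 * L^2) = 46080 * (A * L ^ 3)"
      by (simp add: power2_eq_square power3_eq_cube)
    ultimately have "2 * A + 5120 * A * L * (real n * real n) \<le> 46082 * (A * L ^ 3)" by linarith
    also have "\<dots> \<le> B" using A0 L1 by (simp add: B_def)
    finally show "2 * A + n * (5120 * A * n * L) \<le> B" by (simp add: mult_ac)
  qed simp
  finally have "Lp_norm \<mu> p (kakeya_max d f) \<le> epowr (ennreal (D powr p * B)) (1 / p)"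
    unfolding Lp_norm_def using p by (intro epowr_mono) auto
  also have "\<dots> = ennreal (D * B powr (1 / p))"
    using D0 B1 p by (simp add: powr_mult powr_powr)
  also have "\<dots> \<le> ennreal (2 * 10 ^ 6 * A * L ^ 4 * \<beta> * F)"
  proof (rule ennreal_leI)
    have "B powr (1 / p) \<le> B powr 1" using B1 p by (intro powr_mono) auto
    then have "D * B powr (1 / p) \<le> D * B" using D0 B1 by simp
    also have "\<dots> \<le> (4 * (3 * L) * \<beta> * F) * B"
      unfolding D_def using n \<beta>0 F B1 by (intro mult_right_mono mult_left_mono) auto
    also have "\<dots> = 12 * 10 ^ 5 * A * L ^ 4 * \<beta> * F"
      by (simp add: B_def power4_eq_xxxx power3_eq_cube)
    also have "\<dots> \<le> 2 * 10 ^ 6 * A * L ^ 4 * \<beta> * F"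
      using A0 L1 \<beta>0 F by (intro mult_right_mono) auto
    finally show "D * B powr (1 / p) \<le> 2 * 10 ^ 6 * A * L ^ 4 * \<beta> * F" .
  qed
  finally show ?thesis by (simp add: L_def \<beta>_def)
qed

theorem theorem1p7:
  fixes A :: real
  assumes "A > 0"
  shows "\<exists>C>0. \<forall>(s::real) (p::real) (\<mu>::(real^2) measure) (\<delta>::real) (f::real^2 \<Rightarrow> real).
           0 \<le> s \<longrightarrow> s \<le> 1 \<longrightarrow> frostman_with A s \<mu> \<longrightarrow>
           1 \<le> p \<longrightarrow> p \<le> 1 + s \<longrightarrow>
           0 < \<delta> \<longrightarrow> \<delta> < 1 \<longrightarrow> L1_loc f \<longrightarrow>
           Lp_norm \<mu> p (kakeya_max \<delta> f)
             \<le> ennreal (log_loss C \<delta> * \<delta> powr (1 - 2 / p)) * Lp_norm lebesgue p (\<lambda>y. ennreal \<bar>f y\<bar>)"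
proof -
  define A' where "A' = max 1 (2 * A)"
  define C where "C = 2 * 10 ^ 6 * A'"
  have A': "1 \<le> A'" "2 * A \<le> A'" by (auto simp: A'_def)
  then have C4: "4 \<le> C" by (simp add: C_def)
  have "Lp_norm \<mu> p (kakeya_max \<delta> f)
      \<le> ennreal (log_loss C \<delta> * \<delta> powr (1 - 2 / p)) * Lp_norm lebesgue p (\<lambda>y. ennreal \<bar>f y\<bar>)"
    if s: "0 \<le> s" "s \<le> 1" and mu: "frostman_with A s \<mu>" and p: "1 \<le> p" "p \<le> 1 + s"
      and d: "0 < \<delta>" "\<delta> < 1" and f: "L1_loc f" for s p \<mu> \<delta> f
  proof -
    define c where "c = log_loss C \<delta> * \<delta> powr (1 - 2 / p)"
    have c0: "0 < c" using C4 d by (simp add: c_def log_loss_def)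
    define I where "I = (\<integral>\<^sup>+x. ennreal (\<bar>f x\<bar> powr p) \<partial>lebesgue)"
    have norm: "Lp_norm lebesgue p (\<lambda>y. ennreal \<bar>f y\<bar>) = epowr I (1 / p)"
      by (simp add: Lp_norm_def I_def)
    have main: "Lp_norm \<mu> p (kakeya_max \<delta> f) \<le> ennreal (c * F)"
      if F: "0 < F" "I \<le> ennreal (F powr p)" for F
    proof -
      have frost: "emeasure \<mu> (cball w r \<inter> sphere 0 1) \<le> ennreal (A' * r powr (p - 1))"
        if "norm w = 1" "0 < r" for w r
      proof -
        have "emeasure \<mu> (cball w r \<inter> sphere 0 1) \<le> ennreal (2 * A * r powr (p - 1))"
          using that mu s p assms by (intro frostman_lower_exponent) auto
        also have "\<dots> \<le> ennreal (A' * r powr (p - 1))"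
          using A'(2) by (intro ennreal_leI mult_right_mono) auto
        finally show ?thesis .
      qed
      have "Lp_norm \<mu> p (kakeya_max \<delta> f) \<le> ennreal (2 * 10 ^ 6 * A' * logd \<delta> ^ 4 * \<delta> powr (1 - 2 / p) * F)"
        using d p s A'(1) frost mu F L1_loc_measurable[OF f]
        by (intro strong_type) (auto simp: frostman_with_def borel_measure_on_circle_def I_def)
      also have "\<dots> \<le> ennreal (c * F)"
      proof (intro ennreal_leI mult_right_mono)
        have "logd \<delta> ^ 4 = logd \<delta> powr 4"
          by (subst powr_numeral) auto
        also have "\<dots> \<le> logd \<delta> powr C" using C4 by (intro powr_mono) auto
        finally have "C * logd \<delta> ^ 4 \<le> log_loss C \<delta>"
          unfolding log_loss_def using C4 by (intro mult_left_mono) auto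
        then show "2 * 10 ^ 6 * A' * logd \<delta> ^ 4 * \<delta> powr (1 - 2 / p) \<le> c"
          unfolding c_def C_def[symmetric] by (rule mult_right_mono) simp
      qed (use F in auto)
      finally show ?thesis .
    qed
    show ?thesis
    proof (cases I)
      case top
      then show ?thesis unfolding c_def[symmetric] norm using c0 by (simp add: epowr_def ennreal_mult_top)
    next
      case (real a)
      define F where "F = a powr (1 / p)"
      have "Lp_norm \<mu> p (kakeya_max \<delta> f) \<le> ennreal (c * F)"
      \<comment> \<open>The estimate needs a positive bound for the norm, so the norm is approached from above.\<close>
      proof (rule ennreal_le_epsilon)
        fix e :: real assume "0 < e"
        define F' where "F' = F + e / c"
        have "F < F'" "0 < F'" using \<open>0 < e\<close> c0 by (auto simp: F'_def F_def add_nonneg_pos)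
        have "a = F powr p" using real p by (simp add: F_def powr_powr)
        also have "\<dots> \<le> F' powr p" using \<open>F < F'\<close> p by (intro powr_mono2) (auto simp: F_def)
        finally have "Lp_norm \<mu> p (kakeya_max \<delta> f) \<le> ennreal (c * F')"
          using \<open>0 < F'\<close> real by (intro main) (auto intro: ennreal_leI)
        also have "c * F' = c * F + e" using c0 by (simp add: F'_def field_simps)
        also have "ennreal (c * F + e) = ennreal (c * F) + ennreal e"
          using c0 \<open>0 < e\<close> by (simp add: F_def)
        finally show "Lp_norm \<mu> p (kakeya_max \<delta> f) \<le> ennreal (c * F) + ennreal e" .
      qed
      also have "ennreal (c * F) = ennreal c * Lp_norm lebesgue p (\<lambda>y. ennreal \<bar>f y\<bar>)"
        using c0 real by (simp add: norm F_def ennreal_mult)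
      finally show ?thesis by (simp add: c_def)
    qed
  qed
  then show ?thesis using C4 by (intro exI[of _ C]) auto
qed

end
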